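(* Let $d_1,d_2\geq 1$ be integers with $d_1+d_2\leq n$, and let $I_1,I_2\subseteq\{1,\dots,n\}$ be disjoint subsets with $|I_1|=d_1$ and $|I_2|=d_2$. Then the root system $\Phi^{d_1,d_2}\subseteq BC_n$ associated with the bichromatic graph $\mathcal{G}^{d_1,d_2}$ on $I_1\sqcup I_2$ is equivalent, inside $BC_n$, to $A_{d_1+d_2-1}$, i.e. it lies in the same orbit of the Weyl group $W(BC_n)$ as $\{e_i-e_j : i\ne j\in I_1\sqcup I_2\}$.
   Context: Let $V=\mathbb{C}^n$ with canonical basis $(e_1,\dots,e_n)$ and scalar product $(e_i\mid e_j)=\delta_{ij}$. Then $BC_n=\{\pm e_i\pm e_j : i\neq j\}\cup\{\pm e_i,\pm 2e_i : 1\le i\le n\}$, and its Weyl group $W(BC_n)$ is the group generated by the orthogonal reflections $\sigma_\alpha$, $\alpha\in BC_n$. It acts on the set of root subsystems of $BC_n$ (subsets $\Phi\subseteq BC_n$ with $\sigma_\alpha(\Phi)\subseteq\Phi$ for all $\alpha\in\Phi$), and two root subsystems are called equivalent if they lie in the same orbit. $\mathcal{G}^{d_1,d_2}$ is the graph without loops on nodes $I_1\sqcup I_2$, whose red edges are all pairs of distinct nodes in the same part, and whose green edges are all pairs consisting of a node of $I_1$ and a node of $I_2$. The associated set of roots contains $\pm(e_i-e_j)$ for each red edge $\{i,j\}$ and $\pm(e_i+e_j)$ for each green edge $\{i,j\}$; that is, $$\Phi^{d_1,d_2}=\{\pm(e_i-e_j) : i\ne j,\ i,j\in I_1 \text{ or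 } i,j\in I_2\}\cup\{\pm(e_i+e_j) : i\in I_1,\ j\in I_2\}.$$ *)

theory Defs
  imports
    "HOL-Analysis.Analysis"
    "HOL-Algebra.Bij"
    "HOL-Algebra.Generated_Groups"
    "HOL-Algebra.Group_Action"
begin

text \<open>The coordinates of $\mathbf{C}^n$ are indexed by a finite type with $n$ elements.\<close>

definition e :: "'n::finite \<Rightarrow> complex ^ 'n" where
  "e i = axis i 1"

definition scalar_prod :: "complex ^ 'n \<Rightarrow> complex ^ 'n \<Rightarrow> complex" where
  "scalar_prod x y = (\<Sum>i\<in>UNIV. x $ i * cnj (y $ i))"

text \<open>The inner product of the library on this type is the real part of the Hermitian product, so
  the reflections it defines are not complex linear.  All roots below have real coordinates, so that
  replacing the Hermitian product by the symmetric bilinear one gives the same reflections.\<close>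

definition refl_in :: "complex ^ 'n \<Rightarrow> complex ^ 'n \<Rightarrow> complex ^ 'n" where
  "refl_in \<alpha> v = v - (2 * scalar_prod v \<alpha> / scalar_prod \<alpha> \<alpha>) *s \<alpha>"

definition BC :: "(complex ^ 'n::finite) set" where
  "BC = (\<Union>i. \<Union>j\<in>-{i}. {e i + e j, e i - e j, - e i + e j, - e i - e j})
      \<union> (\<Union>i. {e i, - e i, 2 *s e i, - (2 *s e i)})"

definition weyl_BC :: "(complex ^ 'n::finite \<Rightarrow> complex ^ 'n) monoid" where
  "weyl_BC = (BijGroup UNIV)\<lparr>carrier := generate (BijGroup UNIV) (refl_in ` BC)\<rparr>"

definition root_subsystem :: "(complex ^ 'n::finite) set \<Rightarrow> bool" where
  "root_subsystem \<Phi> \<longleftrightarrow> \<Phi> \<subseteq> BC \<and> (\<forall>\<alpha>\<in>\<Phi>. refl_in \<alpha> ` \<Phi> \<subseteq> \<Phi>)"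

definition equivalent_in_BC :: "(complex ^ 'n::finite) set \<Rightarrow> (complex ^ 'n) set \<Rightarrow> bool" where
  "equivalent_in_BC \<Phi> \<Psi> \<longleftrightarrow>
     root_subsystem \<Phi> \<and> root_subsystem \<Psi> \<and> \<Psi> \<in> orbit weyl_BC (\<lambda>w S. w ` S) \<Phi>"

record 'n bichromatic_graph =
  nodes :: "'n set"
  red_edges :: "'n set set"
  green_edges :: "'n set set"

definition bichromatic_graph_on :: "'n set \<Rightarrow> 'n set \<Rightarrow> 'n bichromatic_graph" where
  "bichromatic_graph_on I1 I2 =
     \<lparr>nodes = I1 \<union> I2,
      red_edges = {{i, j} |i j. i \<noteq> j \<and> (i \<in> I1 \<and> j \<in> I1 \<or> i \<in> I2 \<and> j \<in> I2)},
      green_edges = {{i, j} |i j. i \<in> I1 \<and> j \<in> I2}\<rparr>"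

text \<open>The roots of a graph without loops; a singleton edge would contribute nothing.\<close>

definition graph_roots :: "'n::finite bichromatic_graph \<Rightarrow> (complex ^ 'n) set" where
  "graph_roots G =
     (\<Union>(i, j)\<in>{(i, j). i \<noteq> j \<and> {i, j} \<in> red_edges G}. {e i - e j, - (e i - e j)})
   \<union> (\<Union>(i, j)\<in>{(i, j). i \<noteq> j \<and> {i, j} \<in> green_edges G}. {e i + e j, - (e i + e j)})"

definition A_roots :: "'n::finite set \<Rightarrow> (complex ^ 'n) set" where
  "A_roots J = {e i - e j |i j. i \<in> J \<and> j \<in> J \<and> i \<noteq> j}"

lemma scalar_prod_e: "scalar_prod (e i) (e j) = (if i = j then 1 else 0)"
proof -
  have "scalar_prod (e i) (e j) = (\<Sum>k\<in>UNIV. if k = i then cnj (e j $ k) else 0)"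
    unfolding scalar_prod_def by (rule sum.cong) (auto simp: e_def axis_def)
  then show ?thesis by (auto simp: e_def axis_def)
qed

lemma graph_roots_bichromatic_graph_on:
  assumes "I1 \<inter> I2 = {}"
  shows "graph_roots (bichromatic_graph_on I1 I2) =
     (\<Union>(i, j)\<in>{(i, j). i \<noteq> j \<and> (i \<in> I1 \<and> j \<in> I1 \<or> i \<in> I2 \<and> j \<in> I2)}. {e i - e j, - (e i - e j)})
   \<union> (\<Union>(i, j)\<in>I1 \<times> I2. {e i + e j, - (e i + e j)})"
proof -
  have red: "{(i, j). i \<noteq> j \<and> {i, j} \<in> red_edges (bichromatic_graph_on I1 I2)}
      = {(i, j). i \<noteq> j \<and> (i \<in> I1 \<and> j \<in> I1 \<or> i \<in> I2 \<and> j \<in> I2)}"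
    by (auto simp: bichromatic_graph_on_def doubleton_eq_iff)
  have green: "{(i, j). i \<noteq> j \<and> {i, j} \<in> green_edges (bichromatic_graph_on I1 I2)}
      = I1 \<times> I2 \<union> I2 \<times> I1"
    using assms by (auto simp: bichromatic_graph_on_def doubleton_eq_iff)
  show ?thesis
    unfolding graph_roots_def red green by (auto simp: add.commute)
qed

lemma refl_in_involution: "refl_in \<alpha> (refl_in \<alpha> v) = v"
proof (cases "scalar_prod \<alpha> \<alpha> = 0")
  case True
  then show ?thesis by (simp add: refl_in_def)
next
  case False
  have lin: "scalar_prod (v - c *s \<alpha>) \<alpha> = scalar_prod v \<alpha> - c * scalar_prod \<alpha> \<alpha>" for c
    by (simp add: scalar_prod_def sum_subtractf sum_distrib_left algebra_simps)
  show ?thesis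
    using False unfolding refl_in_def lin
    by (simp add: vec_eq_iff field_simps)
qed

lemma group_weyl_BC: "group (weyl_BC :: (complex ^ 'n::finite \<Rightarrow> complex ^ 'n) monoid)"
proof -
  have "bij (refl_in \<alpha>)" for \<alpha> :: "complex ^ 'n"
    by (rule o_bij[of "refl_in \<alpha>"]) (simp_all add: fun_eq_iff refl_in_involution)
  then have "refl_in ` BC \<subseteq> carrier (BijGroup (UNIV :: (complex ^ 'n) set))"
    by (auto simp: BijGroup_def Bij_def)
  then show ?thesis
    unfolding weyl_BC_def
    by (intro group.subgroup_imp_group group_BijGroup group.generate_is_subgroup)
qed

end

theory Submission imports Defs begin

text \<open>
  The reflection in the short root \<open>e i\<close> only changes the sign of the coordinate \<open>i\<close>, so composing
  these reflections over a set \<open>S\<close> shows that the simultaneous sign change on \<open>S\<close> belongs to the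
  Weyl group.  The sign change on \<open>I2\<close> fixes every \<open>e i\<close> with \<open>i \<in> I1\<close> and negates every \<open>e j\<close> with
  \<open>j \<in> I2\<close>.  It therefore turns each green root \<open>\<plusminus>(e i + e j)\<close> into \<open>\<plusminus>(e i - e j)\<close> and preserves the
  set of red roots, which gives exactly the roots of type A on \<open>I1 \<union> I2\<close>.

  Equivalence is a statement about root subsystems, so closure under reflections has to be proved on
  both sides.  For type A it holds because the reflection in \<open>e i - e j\<close> permutes the basis by
  the transposition of \<open>i\<close> and \<open>j\<close>.  It then passes to the graph roots, since sign changes
  preserve the scalar product and hence conjugate reflections into reflections.
\<close>

lemma scalar_prod_diff_left: "scalar_prod (x - y) z = scalar_prod x z - scalar_prod y z"
  by (simp add: scalar_prod_def algebra_simps sum_subtractf)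

lemma scalar_prod_diff_right: "scalar_prod x (y - z) = scalar_prod x y - scalar_prod x z"
  by (simp add: scalar_prod_def algebra_simps sum_subtractf)

lemma refl_in_diff: "refl_in \<alpha> (x - y) = refl_in \<alpha> x - refl_in \<alpha> y"
  by (simp add: refl_in_def scalar_prod_diff_left vec_eq_iff diff_divide_distrib algebra_simps)

lemma refl_in_e: "refl_in (e i) v = (\<chi> k. if k = i then - v $ k else v $ k)"
proof -
  have "scalar_prod v (e i) = (\<Sum>k\<in>UNIV. if k = i then v $ k else 0)"
    unfolding scalar_prod_def by (rule sum.cong) (auto simp: e_def axis_def)
  then have "scalar_prod v (e i) = v $ i"
    by simp
  then show ?thesis
    unfolding refl_in_def scalar_prod_e by (simp add: vec_eq_iff e_def axis_def)
qed

lemma refl_in_e_diff_e: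
  assumes "i \<noteq> j"
  shows "refl_in (e i - e j) (e k) = e (Transposition.transpose i j k)"
  using assms
  by (auto simp: refl_in_def scalar_prod_diff_left scalar_prod_diff_right scalar_prod_e
      Transposition.transpose_def)

lemma root_subsystem_A_roots: "root_subsystem (A_roots J)"
  unfolding root_subsystem_def
proof (intro conjI ballI subsetI)
  fix x assume "x \<in> A_roots J"
  then show "x \<in> BC"
    by (auto simp: A_roots_def BC_def)
next
  fix \<alpha> x
  assume "\<alpha> \<in> A_roots J" and "x \<in> refl_in \<alpha> ` A_roots J"
  then obtain i j k l where ij: "i \<in> J" "j \<in> J" "i \<noteq> j" and kl: "k \<in> J" "l \<in> J" "k \<noteq> l"
    and x: "x = refl_in (e i - e j) (e k - e l)"
    by (auto simp: A_roots_def)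
  let ?\<tau> = "Transposition.transpose i j"
  have "x = e (?\<tau> k) - e (?\<tau> l)"
    using ij(3) by (simp add: x refl_in_diff refl_in_e_diff_e)
  moreover have "?\<tau> k \<in> J" "?\<tau> l \<in> J" "?\<tau> k \<noteq> ?\<tau> l"
    using ij kl by (auto simp: Transposition.transpose_def)
  ultimately show "x \<in> A_roots J"
    by (auto simp: A_roots_def)
qed

definition sign_change :: "'n::finite set \<Rightarrow> complex ^ 'n \<Rightarrow> complex ^ 'n" where
  "sign_change S v = (\<chi> k. if k \<in> S then - v $ k else v $ k)"

lemma sign_change_linear:
  "sign_change S (x + y) = sign_change S x + sign_change S y"
  "sign_change S (x - y) = sign_change S x - sign_change S y"
  "sign_change S (- x) = - sign_change S x"
  "sign_change S (c *s x) = c *s sign_change S x"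
  by (auto simp: sign_change_def vec_eq_iff)

lemma sign_change_e: "sign_change S (e i) = (if i \<in> S then - e i else e i)"
  by (auto simp: sign_change_def e_def axis_def vec_eq_iff)

lemma sign_change_involution: "sign_change S (sign_change S v) = v"
  by (auto simp: sign_change_def vec_eq_iff)

lemma scalar_prod_sign_change:
  "scalar_prod (sign_change S x) (sign_change S y) = scalar_prod x y"
  unfolding scalar_prod_def by (rule sum.cong) (auto simp: sign_change_def)

text \<open>A map that is linear and preserves the scalar product conjugates the reflection in \<open>\<alpha>\<close> into
  the reflection in the image of \<open>\<alpha>\<close>; this is what carries root subsystems to root subsystems.\<close>

lemma refl_in_sign_change:
  "refl_in (sign_change S \<alpha>) (sign_change S v) = sign_change S (refl_in \<alpha> v)"
  by (simp add: refl_in_def scalar_prod_sign_change sign_change_linear)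

lemma sign_change_BC:
  fixes x :: "complex ^ 'n::finite"
  assumes "x \<in> BC"
  shows "sign_change S x \<in> BC"
proof -
  have axis_root: "e i \<in> BC" "- e i \<in> BC" "2 *s e i \<in> BC" "- (2 *s e i) \<in> BC" for i :: 'n
    unfolding BC_def by (rule UnI2, rule UN_I[of i], simp, simp)+
  have pair_root: "e i + e j \<in> BC" "e i - e j \<in> BC" "- e i + e j \<in> BC" "- e i - e j \<in> BC"
    if "j \<noteq> i" for i j :: 'n
    unfolding BC_def
    by (rule UnI1, rule UN_I[of i], simp, rule UN_I[of j], use that in simp, simp)+
  from assms consider i j where "j \<noteq> i" "x \<in> {e i + e j, e i - e j, - e i + e j, - e i - e j}"
    | i where "x \<in> {e i, - e i, 2 *s e i, - (2 *s e i)}"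
    unfolding BC_def UN_iff Un_iff Bex_def Compl_iff singleton_iff by metis
  then show ?thesis
  proof cases
    case 1
    then show ?thesis
      using pair_root[OF 1(1)] pair_root[OF 1(1)[symmetric]]
      by (auto simp: add.commute sign_change_linear sign_change_e)
  next
    case 2
    then show ?thesis
      using axis_root[of i] by (auto simp: sign_change_linear sign_change_e)
  qed
qed

lemma root_subsystem_sign_change:
  assumes "root_subsystem \<Phi>"
  shows "root_subsystem (sign_change S ` \<Phi>)"
  using assms sign_change_BC unfolding root_subsystem_def
  by (auto simp: refl_in_sign_change image_subset_iff)

lemma sign_change_Bij: "sign_change S \<in> Bij UNIV"
proof -
  have "bij (sign_change S)"
    by (rule o_bij[of "sign_change S"]) (simp_all add: fun_eq_iff sign_change_involution)
  then show ?thesis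
    by (simp add: Bij_def)
qed

lemma sign_change_singleton: "sign_change {i} = refl_in (e i)"
  by (simp add: fun_eq_iff refl_in_e sign_change_def vec_eq_iff)

lemma sign_change_insert:
  assumes "i \<notin> S"
  shows "sign_change (insert i S) = sign_change {i} \<circ> sign_change S"
  using assms by (auto simp: fun_eq_iff sign_change_def vec_eq_iff)

text \<open>One reflection \<open>refl_in (e i)\<close> for each \<open>i \<in> S\<close> produces the sign change on \<open>S\<close>.\<close>

lemma sign_change_in_weyl_BC:
  fixes S :: "'n::finite set"
  shows "sign_change S \<in> carrier weyl_BC"
proof -
  let ?G = "BijGroup (UNIV :: (complex ^ 'n) set)"
  have "sign_change S \<in> generate ?G (refl_in ` BC)"
    using finite[of S]
  proof (induction S rule: finite_induct)
    case empty
    have "sign_change {} = \<one>\<^bsub>?G\<^esub>"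
      by (simp add: fun_eq_iff BijGroup_def sign_change_def)
    then show ?case
      by (simp add: generate.one)
  next
    case (insert i S)
    have "e i \<in> BC"
      by (auto simp: BC_def)
    then have "sign_change {i} \<in> generate ?G (refl_in ` BC)"
      unfolding sign_change_singleton by (intro generate.incl imageI)
    moreover have "sign_change (insert i S) = sign_change {i} \<otimes>\<^bsub>?G\<^esub> sign_change S"
      by (simp add: sign_change_insert[OF insert.hyps(2)] BijGroup_def sign_change_Bij
          compose_def fun_eq_iff)
    ultimately show ?case
      using insert.IH by (simp add: generate.eng)
  qed
  then show ?thesis
    by (simp add: weyl_BC_def)
qed

lemma sign_change_graph_roots:
  assumes "I1 \<inter> I2 = {}"
  shows "sign_change I2 ` graph_roots (bichromatic_graph_on I1 I2) = A_roots (I1 \<union> I2)"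
proof (intro equalityI subsetI)
  let ?\<Phi> = "graph_roots (bichromatic_graph_on I1 I2)"
  have A: "e i - e j \<in> A_roots (I1 \<union> I2)" if "i \<in> I1 \<union> I2" "j \<in> I1 \<union> I2" "i \<noteq> j" for i j
    using that unfolding A_roots_def by blast
  have disj: "i \<notin> I2" if "i \<in> I1" for i
    using assms that by blast
  fix x assume "x \<in> sign_change I2 ` ?\<Phi>"
  then obtain y where y: "y \<in> ?\<Phi>" and x: "x = sign_change I2 y"
    by blast
  from y consider
    i j where "i \<noteq> j" "i \<in> I1 \<and> j \<in> I1 \<or> i \<in> I2 \<and> j \<in> I2" "y \<in> {e i - e j, - (e i - e j)}"
    | i j where "i \<in> I1" "j \<in> I2" "y \<in> {e i + e j, - (e i + e j)}"
    unfolding graph_roots_bichromatic_graph_on[OF assms] UN_iff Un_iff mem_Collect_eq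
      Bex_def split_paired_Ex case_prod_conv mem_Sigma_iff
    by metis
  then show "x \<in> A_roots (I1 \<union> I2)"
  proof cases
    case 1
    then show ?thesis
      using A[of i j] A[of j i] disj[of i] disj[of j]
      by (auto simp: x sign_change_linear sign_change_e)
  next
    case 2
    then have "i \<noteq> j" "i \<notin> I2"
      using disj by blast+
    with 2 show ?thesis
      using A[of i j] A[of j i] by (auto simp: x sign_change_linear sign_change_e)
  qed
next
  let ?\<Phi> = "graph_roots (bichromatic_graph_on I1 I2)"
  have red: "e i - e j \<in> ?\<Phi>"
    if "i \<noteq> j" "i \<in> I1 \<and> j \<in> I1 \<or> i \<in> I2 \<and> j \<in> I2" for i j
    unfolding graph_roots_bichromatic_graph_on[OF assms]
    by (intro UnI1 UN_I[of "(i, j)"]) (use that in simp_all)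
  have green: "e i + e j \<in> ?\<Phi>" "- (e i + e j) \<in> ?\<Phi>" if "i \<in> I1" "j \<in> I2" for i j
    unfolding graph_roots_bichromatic_graph_on[OF assms]
    by (intro UnI2 UN_I[of "(i, j)"]; use that in simp)+
  have disj: "i \<notin> I2" if "i \<in> I1" for i
    using assms that by blast
  fix x assume "x \<in> A_roots (I1 \<union> I2)"
  then obtain i j where ij: "i \<in> I1 \<union> I2" "j \<in> I1 \<union> I2" "i \<noteq> j" and x: "x = e i - e j"
    by (auto simp: A_roots_def)
  have flip: "sign_change I2 x =
      (if i \<in> I2 then - e i else e i) - (if j \<in> I2 then - e j else e j)"
    by (simp add: x sign_change_linear sign_change_e)
  consider "i \<in> I1" "j \<in> I1" | "i \<in> I2" "j \<in> I2" | "i \<in> I1" "j \<in> I2" | "i \<in> I2" "j \<in> I1"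
    using ij by blast
  then have "sign_change I2 x \<in> ?\<Phi>"
  proof cases
    case 1
    then show ?thesis
      using red[of i j] ij(3) disj by (simp add: flip)
  next
    case 2
    then show ?thesis
      using red[of j i] ij(3) by (simp add: flip)
  next
    case 3
    then show ?thesis
      using green(1)[of i j] disj by (simp add: flip)
  next
    case 4
    then show ?thesis
      using green(2)[of j i] disj by (simp add: flip add.commute[of "e j" "e i"])
  qed
  then show "x \<in> sign_change I2 ` ?\<Phi>"
    by (metis sign_change_involution imageI)
qed

theorem lemma4p2p1:
  fixes I1 I2 :: "'n::finite set" and d1 d2 :: nat
  assumes "d1 \<ge> 1" and "d2 \<ge> 1" and "d1 + d2 \<le> CARD('n)"
    and "I1 \<inter> I2 = {}" and "card I1 = d1" and "card I2 = d2"
  shows "equivalent_in_BC (graph_roots (bichromatic_graph_on I1 I2)) (A_roots (I1 \<union> I2))"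
proof -
  let ?\<Phi> = "graph_roots (bichromatic_graph_on I1 I2)"
  have to_A: "sign_change I2 ` ?\<Phi> = A_roots (I1 \<union> I2)"
    using assms(4) by (rule sign_change_graph_roots)
  have "?\<Phi> = sign_change I2 ` A_roots (I1 \<union> I2)"
    by (simp add: to_A[symmetric] image_image sign_change_involution)
  then have "root_subsystem ?\<Phi>"
    using root_subsystem_sign_change[OF root_subsystem_A_roots] by metis
  moreover have "A_roots (I1 \<union> I2) \<in> orbit weyl_BC (\<lambda>w S. w ` S) ?\<Phi>"
    unfolding orbit_def using sign_change_in_weyl_BC[of I2] to_A by blast
  ultimately show ?thesis
    by (simp add: equivalent_in_BC_def root_subsystem_A_roots)
qed

end
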